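(* Let $k\ge1$ be an integer, $\lambda>0$, and let $\{N^{(k)}(t)\}_{t\ge0}$ be the Poisson process of order $k$ with parameter $\lambda$. Then $$\lim_{t\to\infty}\frac{N^{(k)}(t)}{t}=\frac{k(k+1)}{2}\lambda\quad\text{in probability.}$$
   Context: Poisson process of order $k$ (PPoK) with parameter $\lambda$: $N^{(k)}(t)=\sum_{i=0}^{N(t,k\lambda)}X_i$, where $\{N(t,k\lambda)\}_{t\ge0}$ is a Poisson process of rate $k\lambda$, $X_0\equiv 0$, and $\{X_i\}_{i\ge 1}$ are IID uniform on $\{1,2,\ldots,k\}$, independent of the Poisson process. *)

theory Defs
  imports "HOL-Probability.Probability"
begin

context prob_space
begin

text \<open>
  A family indexed by all reals represents a process in continuous time; only its values at
  times in \<open>{0..}\<close> are relevant. Increments are taken in \<^typ>\<open>int\<close>, since subtraction on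
  \<^typ>\<open>nat\<close> truncates. The increment law is required for \<open>s < t\<close> only, because
  \<^const>\<open>poisson_pmf\<close> is meaningful for positive rates only.
\<close>
definition poisson_process :: "real \<Rightarrow> (real \<Rightarrow> 'a \<Rightarrow> nat) \<Rightarrow> bool" where
  "poisson_process r N \<longleftrightarrow>
     (\<forall>t\<ge>0. random_variable (count_space UNIV) (N t)) \<and>
     (AE \<omega> in M. N 0 \<omega> = 0 \<and> mono_on {0..} (\<lambda>t. N t \<omega>) \<and>
                 (\<forall>t\<ge>0. continuous (at_right t) (\<lambda>u. N u \<omega>))) \<and>
     (\<forall>n (\<tau> :: nat \<Rightarrow> real). 0 \<le> \<tau> 0 \<and> (\<forall>i<n. \<tau> i \<le> \<tau> (Suc i)) \<longrightarrow>
        indep_vars (\<lambda>_. count_space UNIV)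
          (\<lambda>i \<omega>. int (N (\<tau> (Suc i)) \<omega>) - int (N (\<tau> i) \<omega>)) {..<n}) \<and>
     (\<forall>s t. 0 \<le> s \<and> s < t \<longrightarrow>
        distr M (count_space UNIV) (\<lambda>\<omega>. int (N t \<omega>) - int (N s \<omega>)) =
        measure_pmf (map_pmf int (poisson_pmf (r * (t - s)))))"

text \<open>
  \<open>N\<close> is the underlying Poisson process of rate \<open>k * lam\<close> and \<open>X\<close> the sequence of jump sizes.
  The final independence condition is between the whole process \<open>(N t)\<close>, \<open>t \<ge> 0\<close>, and the
  whole sequence \<open>(X i)\<close>, \<open>i \<ge> 1\<close>, as random elements of the product spaces.
\<close>
definition poisson_process_of_order :: "nat \<Rightarrow> real \<Rightarrow> (real \<Rightarrow> 'a \<Rightarrow> nat) \<Rightarrow> bool" where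
  "poisson_process_of_order k lam Nk \<longleftrightarrow>
     (\<exists>(N :: real \<Rightarrow> 'a \<Rightarrow> nat) (X :: nat \<Rightarrow> 'a \<Rightarrow> nat).
        poisson_process (real k * lam) N \<and>
        (\<forall>\<omega>\<in>space M. X 0 \<omega> = 0) \<and>
        indep_vars (\<lambda>_. count_space UNIV) X {1..} \<and>
        (\<forall>i\<ge>1. distr M (count_space UNIV) (X i) = measure_pmf (pmf_of_set {1..k})) \<and>
        indep_var
          (\<Pi>\<^sub>M t\<in>{0..}. count_space UNIV) (\<lambda>\<omega>. \<lambda>t\<in>{0..}. N t \<omega>)
          (\<Pi>\<^sub>M i\<in>{1..}. count_space UNIV) (\<lambda>\<omega>. \<lambda>i\<in>{1..}. X i \<omega>) \<and>
        (\<forall>t\<ge>0. \<forall>\<omega>\<in>space M. Nk t \<omega> = (\<Sum>i = 0..N t \<omega>. X i \<omega>)))"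

text \<open>
  Measurability is part of the definition because \<^const>\<open>measure\<close> is 0 on non-measurable sets.
\<close>
definition tendsto_in_probability ::
  "('b \<Rightarrow> 'a \<Rightarrow> real) \<Rightarrow> ('a \<Rightarrow> real) \<Rightarrow> 'b filter \<Rightarrow> bool" where
  "tendsto_in_probability Y L F \<longleftrightarrow>
     random_variable borel L \<and>
     (\<forall>\<^sub>F t in F. random_variable borel (Y t)) \<and>
     (\<forall>\<epsilon>>0. ((\<lambda>t. prob {\<omega> \<in> space M. \<bar>Y t \<omega> - L \<omega>\<bar> > \<epsilon>}) \<longlongrightarrow> 0) F)"

end

end

theory Submission
  imports Defs
begin

text \<open>
  Write \<open>r = k * lam\<close>, let \<open>m\<close> and \<open>v\<close> be the mean and the variance of the uniform
  distribution on \<open>{1..k}\<close>, and compare \<open>Nk t\<close> with the sum of a deterministic number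
  \<open>n = \<lfloor>r * t\<rfloor>\<close> of jumps. Since every jump is at most \<open>k\<close>,
  \<open>\<bar>Nk t - m * r * t\<bar> \<le> k * \<bar>N t - r * t\<bar> + \<bar>\<Sum>i=1..n. X i - m\<bar> + (k + m)\<close>.
  The squares of the first two summands have means \<open>k^2 * r * t\<close> and \<open>v * n\<close>, so the mean square
  of \<open>Nk t - m * r * t\<close> is \<open>O(t)\<close>, and Chebyshev's inequality bounds the probability of a
  deviation by \<open>\<epsilon> * t\<close> by a constant multiple of \<open>1 / t\<close>.
\<close>

section \<open>The variance of the Poisson distribution\<close>

lemma nn_integral_poisson_pmf:
  assumes "rate > 0" "\<And>n. f n \<ge> 0" "(\<lambda>n. rate ^ n / fact n * exp (-rate) * f n) sums s"
  shows "(\<integral>\<^sup>+n. ennreal (f n) \<partial>measure_pmf (poisson_pmf rate)) = ennreal s"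
proof -
  have "(\<integral>\<^sup>+n. ennreal (f n) \<partial>measure_pmf (poisson_pmf rate)) =
      (\<Sum>n. ennreal (rate ^ n / fact n * exp (-rate) * f n))"
    using assms(1,2) unfolding nn_integral_measure_pmf nn_integral_count_space_nat
    by (simp flip: ennreal_mult'')
  also have "\<dots> = ennreal s"
    using assms sums_unique[OF assms(3)]
    by (subst suminf_ennreal_eq[OF _ assms(3)]) auto
  finally show ?thesis .
qed

lemma poisson_weights_sums:
  fixes rate :: real
  shows "(\<lambda>n. rate ^ n / fact n * exp (-rate)) sums 1"
proof -
  have "(\<lambda>n. rate ^ n / fact n) sums exp rate"
    using exp_converges[of rate] by (simp add: scaleR_conv_of_real field_simps)
  from sums_mult2[OF this, of "exp (-rate)"] show ?thesis
    by (simp add: mult_exp_exp)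
qed

text \<open>Since \<open>n / fact n = 1 / fact (n - 1)\<close> for positive \<open>n\<close>, the
  factor \<open>real n\<close> can be traded for \<open>rate\<close> and an index shift. With
  \<open>g\<close> constantly 1 this yields the mean, with \<open>g = real\<close> the second
  factorial moment.\<close>

lemma poisson_weights_sums_shift:
  fixes rate :: real
  assumes "(\<lambda>n. rate ^ n / fact n * exp (-rate) * g n) sums s"
  shows "(\<lambda>n. rate ^ n / fact n * exp (-rate) * (real n * g (n - 1))) sums (rate * s)"
\<comment> \<open>The term at 0 vanishes because of the factor \<open>real n\<close>, so the
  truncated \<open>n - 1\<close> does no harm there.\<close>
proof (rule sums_Suc_imp)
  have "rate ^ Suc n / fact (Suc n) * exp (-rate) * (real (Suc n) * g (Suc n - 1)) =
      rate * (rate ^ n / fact n * exp (-rate) * g n)" for n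
    by (simp add: divide_simps del: of_nat_Suc)
  then show "(\<lambda>n. rate ^ Suc n / fact (Suc n) * exp (-rate) * (real (Suc n) * g (Suc n - 1)))
      sums (rate * s)"
    using sums_mult[OF assms, of rate] by (simp only:)
qed simp

text \<open>The square expands into factorial moments:
  \<open>(n - rate)^2 = n * (n - 1) + (1 - 2 * rate) * n + rate^2\<close>, and the three series sum
  to multiples of \<open>rate^2\<close>, \<open>rate\<close> and 1.\<close>

lemma nn_integral_poisson_pmf_variance:
  assumes "rate > 0"
  shows "(\<integral>\<^sup>+n. ennreal ((real n - rate)\<^sup>2) \<partial>measure_pmf (poisson_pmf rate)) = ennreal rate"
proof (rule nn_integral_poisson_pmf[OF assms])
  let ?w = "\<lambda>n. rate ^ n / fact n * exp (-rate)"
  have 0: "?w sums 1"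
    by (rule poisson_weights_sums)
  have 1: "(\<lambda>n. ?w n * real n) sums rate"
    using poisson_weights_sums_shift[of rate "\<lambda>_. 1" 1] 0 by simp
  have "(\<lambda>n. ?w n * (real n * real (n - 1))) sums (rate * rate)"
    using poisson_weights_sums_shift[of rate real] 1 by simp
  then have "(\<lambda>n. ?w n * (real n * real (n - 1)) + (1 - 2 * rate) * (?w n * real n) + rate\<^sup>2 * ?w n)
      sums (rate * rate + (1 - 2 * rate) * rate + rate\<^sup>2 * 1)"
    by (intro sums_add sums_mult 0 1)
  also have "(\<lambda>n. ?w n * (real n * real (n - 1)) + (1 - 2 * rate) * (?w n * real n) + rate\<^sup>2 * ?w n)
      = (\<lambda>n. ?w n * (real n - rate)\<^sup>2)"
  proof
    fix n
    have *: "real n * real (n - 1) = (real n)\<^sup>2 - real n"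
      by (cases n) (auto simp: power2_eq_square algebra_simps)
    \<comment> \<open>With the weight replaced by an arbitrary \<open>w\<close>, this is a
      polynomial identity.\<close>
    have "w * (real n * real (n - 1)) + (1 - 2 * rate) * (w * real n) + rate\<^sup>2 * w
        = w * (real n - rate)\<^sup>2" for w
      unfolding * power2_diff by (simp add: algebra_simps)
    then show "?w n * (real n * real (n - 1)) + (1 - 2 * rate) * (?w n * real n) + rate\<^sup>2 * ?w n
        = ?w n * (real n - rate)\<^sup>2" .
  qed
  also have "rate * rate + (1 - 2 * rate) * rate + rate\<^sup>2 * 1 = rate"
    by (simp add: power2_eq_square algebra_simps)
  finally show "(\<lambda>n. ?w n * (real n - rate)\<^sup>2) sums rate" .
qed auto

text \<open>The two sums differ by \<open>|a - b|\<close> terms. This allows a random number of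
  jumps to be replaced by a deterministic one.\<close>

lemma abs_diff_sum_le:
  fixes f :: "nat \<Rightarrow> real"
  assumes "\<And>i. i \<ge> 1 \<Longrightarrow> \<bar>f i\<bar> \<le> c"
  shows "\<bar>(\<Sum>i=1..a. f i) - (\<Sum>i=1..b. f i)\<bar> \<le> c * \<bar>real a - real b\<bar>"
proof -
  have *: "\<bar>(\<Sum>i=1..b. f i) - (\<Sum>i=1..a. f i)\<bar> \<le> c * (real b - real a)" if "a \<le> b" for a b
    using that
  proof (induction rule: dec_induct)
    case (step j)
    then show ?case
      using assms[of "Suc j"] by (simp add: algebra_simps)
  qed simp
  show ?thesis
    using *[of a b] *[of b a] by (cases a b rule: le_cases) (simp_all add: abs_minus_commute)
qed

section \<open>Second moments of independent sums, and Chebyshev's inequality\<close>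

context prob_space
begin

text \<open>Expanding the square, the off-diagonal terms vanish by independence and centering, and
  each diagonal term contributes \<open>v\<close>.\<close>

lemma second_moment_sum_indep:
  fixes Y :: "'i \<Rightarrow> 'a \<Rightarrow> real"
  assumes I: "finite I" and ind: "indep_vars (\<lambda>_. borel) Y I"
    and sq: "\<And>i. i \<in> I \<Longrightarrow> integrable M (\<lambda>\<omega>. (Y i \<omega>)\<^sup>2)"
    and mean: "\<And>i. i \<in> I \<Longrightarrow> expectation (Y i) = 0"
    and var: "\<And>i. i \<in> I \<Longrightarrow> expectation (\<lambda>\<omega>. (Y i \<omega>)\<^sup>2) = v"
  shows "integrable M (\<lambda>\<omega>. (\<Sum>i\<in>I. Y i \<omega>)\<^sup>2)"
    and "expectation (\<lambda>\<omega>. (\<Sum>i\<in>I. Y i \<omega>)\<^sup>2) = real (card I) * v"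
proof -
  have rv: "Y i \<in> borel_measurable M" if "i \<in> I" for i
    using ind that by (auto simp: indep_vars_def)
  have int: "integrable M (Y i)" if "i \<in> I" for i
    using square_integrable_imp_integrable[OF rv sq] that by simp
  have prod: "integrable M (\<lambda>\<omega>. Y i \<omega> * Y j \<omega>) \<and>
      expectation (\<lambda>\<omega>. Y i \<omega> * Y j \<omega>) = (if i = j then v else 0)" if "i \<in> I" "j \<in> I" for i j
  proof (cases "i = j")
    case True
    then show ?thesis
      using sq var that by (simp flip: power2_eq_square)
  next
    case False
    have ind': "indep_vars (\<lambda>_. borel) Y {i, j}"
      using ind that by (intro indep_vars_subset[OF ind]) auto
    \<comment> \<open>As \<open>i\<close> and \<open>j\<close> are distinct, the product over the
      set \<open>{i, j}\<close> is the product of the two variables.\<close>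
    have "integrable M (\<lambda>\<omega>. \<Prod>l\<in>{i, j}. Y l \<omega>)"
      using int that by (intro indep_vars_integrable ind') auto
    moreover have "expectation (\<lambda>\<omega>. \<Prod>l\<in>{i, j}. Y l \<omega>) = (\<Prod>l\<in>{i, j}. expectation (Y l))"
      using int that by (intro indep_vars_lebesgue_integral ind') auto
    ultimately show ?thesis
      using False mean that by simp
  qed
  have eq: "(\<Sum>i\<in>I. Y i \<omega>)\<^sup>2 = (\<Sum>i\<in>I. \<Sum>j\<in>I. Y i \<omega> * Y j \<omega>)" for \<omega>
    by (simp add: power2_eq_square sum_product)
  show "integrable M (\<lambda>\<omega>. (\<Sum>i\<in>I. Y i \<omega>)\<^sup>2)"
    unfolding eq using prod by auto
  have "expectation (\<lambda>\<omega>. (\<Sum>i\<in>I. Y i \<omega>)\<^sup>2) = (\<Sum>i\<in>I. \<Sum>j\<in>I. if i = j then v else 0)"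
    unfolding eq using prod by (simp add: Bochner_Integration.integral_sum)
  also have "\<dots> = real (card I) * v"
    using I by simp
  finally show "expectation (\<lambda>\<omega>. (\<Sum>i\<in>I. Y i \<omega>)\<^sup>2) = real (card I) * v" .
qed

text \<open>Chebyshev's inequality: a mean square of at most \<open>C * t\<close> against the
  squared threshold \<open>(\<epsilon> * t)^2\<close> leaves a probability of order
  \<open>1 / t\<close>. The nonnegative integral spares a separate proof of integrability.\<close>

lemma tendsto_in_probability_linear_second_moment:
  fixes Z :: "real \<Rightarrow> 'a \<Rightarrow> real"
  assumes Z: "\<And>t. t > 0 \<Longrightarrow> random_variable borel (Z t)"
    and bound: "\<And>t. t \<ge> 1 \<Longrightarrow> (\<integral>\<^sup>+\<omega>. ennreal ((Z t \<omega> - c * t)\<^sup>2) \<partial>M) \<le> ennreal (C * t)"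
    and C: "C \<ge> 0"
  shows "tendsto_in_probability (\<lambda>t \<omega>. Z t \<omega> / t) (\<lambda>_. c) at_top"
  unfolding tendsto_in_probability_def
proof (intro conjI allI impI)
  show "random_variable borel (\<lambda>_. c)"
    by simp
  show "\<forall>\<^sub>F t in at_top. random_variable borel (\<lambda>\<omega>. Z t \<omega> / t)"
    using eventually_gt_at_top[of 0] by eventually_elim (use Z in auto)
  fix \<epsilon> :: real
  assume e: "\<epsilon> > 0"
  have le: "prob {\<omega> \<in> space M. \<bar>Z t \<omega> / t - c\<bar> > \<epsilon>} \<le> C / \<epsilon>\<^sup>2 / t" if t1: "t \<ge> 1" for t
  proof -
    have t: "t > 0"
      using t1 by simp
    have [measurable]: "Z t \<in> borel_measurable M"
      by (rule Z[OF t])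
    let ?u = "\<lambda>\<omega>. ennreal ((Z t \<omega> - c * t)\<^sup>2)" and ?b = "ennreal (1 / (\<epsilon> * t)\<^sup>2)"
    \<comment> \<open>The deviation event is put into the form in which Markov's inequality applies
      to the squared deviation.\<close>
    have "1 \<le> ?b * ?u \<omega>" if "\<bar>Z t \<omega> / t - c\<bar> > \<epsilon>" for \<omega>
    proof -
      have "\<bar>Z t \<omega> / t - c\<bar> = \<bar>Z t \<omega> - c * t\<bar> / t"
        using t by (simp add: abs_if field_simps)
      then have "\<epsilon> * t \<le> \<bar>Z t \<omega> - c * t\<bar>"
        using that t by (simp add: field_simps)
      then have "(\<epsilon> * t)\<^sup>2 \<le> (Z t \<omega> - c * t)\<^sup>2"
        using e t by (metis abs_le_square_iff abs_of_pos mult_pos_pos)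
      then have "1 \<le> 1 / (\<epsilon> * t)\<^sup>2 * (Z t \<omega> - c * t)\<^sup>2"
        using e t by simp
      then show ?thesis
        by (metis ennreal_1 ennreal_leI ennreal_mult'' zero_le_power2)
    qed
    then have "emeasure M {\<omega> \<in> space M. \<bar>Z t \<omega> / t - c\<bar> > \<epsilon>} \<le> emeasure M {\<omega> \<in> space M. 1 \<le> ?b * ?u \<omega>}"
      by (intro emeasure_mono) auto
    also have "\<dots> \<le> ?b * (\<integral>\<^sup>+\<omega>. ?u \<omega> * indicator (space M) \<omega> \<partial>M)"
      by (rule nn_integral_Markov_inequality) auto
    also have "\<dots> = ?b * (\<integral>\<^sup>+\<omega>. ?u \<omega> \<partial>M)"
      by (intro arg_cong2[where f = "(*)"] nn_integral_cong refl) simp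
    also have "\<dots> \<le> ?b * ennreal (C * t)"
      by (intro mult_left_mono bound t1) simp
    also have "\<dots> = ennreal (C / \<epsilon>\<^sup>2 / t)"
      using e t C by (simp add: power2_eq_square field_simps flip: ennreal_mult)
    finally show ?thesis
      using C t by (simp add: emeasure_eq_measure)
  qed
  show "((\<lambda>t. prob {\<omega> \<in> space M. \<bar>Z t \<omega> / t - c\<bar> > \<epsilon>}) \<longlongrightarrow> 0) at_top"
  proof (rule tendsto_sandwich[where f = "\<lambda>_. 0" and h = "\<lambda>t. C / \<epsilon>\<^sup>2 / t"])
    show "\<forall>\<^sub>F t in at_top. prob {\<omega> \<in> space M. \<bar>Z t \<omega> / t - c\<bar> > \<epsilon>} \<le> C / \<epsilon>\<^sup>2 / t"
      using eventually_ge_at_top[of 1] by eventually_elim (rule le)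
    show "((\<lambda>t. C / \<epsilon>\<^sup>2 / t) \<longlongrightarrow> 0) at_top"
      by (intro tendsto_divide_0[OF tendsto_const] filterlim_at_top_imp_at_infinity filterlim_ident)
  qed auto
qed

text \<open>The definition gives laws of increments only; almost surely \<open>N 0\<close> is 0, so
  \<open>N t\<close> agrees with the increment over \<open>[0, t]\<close>, and \<open>nat\<close>
  undoes the passage to integers.\<close>

lemma poisson_process_nn_integral:
  assumes "poisson_process r N" "t > 0"
  shows "(\<integral>\<^sup>+\<omega>. g (N t \<omega>) \<partial>M) = (\<integral>\<^sup>+n. g n \<partial>measure_pmf (poisson_pmf (r * t)))"
proof -
  have [measurable]: "N t \<in> measurable M (count_space UNIV)" "N 0 \<in> measurable M (count_space UNIV)"
    and AE: "AE \<omega> in M. N 0 \<omega> = 0"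
    using assms by (auto simp: poisson_process_def)
  have law: "distr M (count_space UNIV) (\<lambda>\<omega>. int (N t \<omega>) - int (N 0 \<omega>)) =
      measure_pmf (map_pmf int (poisson_pmf (r * t)))"
    using assms by (simp add: poisson_process_def)
  have "(\<integral>\<^sup>+\<omega>. g (N t \<omega>) \<partial>M) = (\<integral>\<^sup>+\<omega>. g (nat (int (N t \<omega>) - int (N 0 \<omega>))) \<partial>M)"
    using AE by (intro nn_integral_cong_AE) auto
  also have "\<dots> = (\<integral>\<^sup>+z. g (nat z) \<partial>distr M (count_space UNIV) (\<lambda>\<omega>. int (N t \<omega>) - int (N 0 \<omega>)))"
    by (rule nn_integral_distr[symmetric]) auto
  also have "\<dots> = (\<integral>\<^sup>+n. g n \<partial>measure_pmf (poisson_pmf (r * t)))"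
    unfolding law by simp
  finally show ?thesis .
qed

end

section \<open>The mean square estimate for the process of order \<open>k\<close>\<close>

theorem lemma3p2:
  fixes M :: "'a measure" and k :: nat and lam :: real and Nk :: "real \<Rightarrow> 'a \<Rightarrow> nat"
  assumes "prob_space M"
    and "k \<ge> 1"
    and "lam > 0"
    and "prob_space.poisson_process_of_order M k lam Nk"
  shows "prob_space.tendsto_in_probability M (\<lambda>t \<omega>. real (Nk t \<omega>) / t)
           (\<lambda>_. real k * (real k + 1) / 2 * lam) at_top"
proof -
  interpret prob_space M by fact
  obtain N X where N: "poisson_process (real k * lam) N"
    and X0: "\<And>\<omega>. \<omega> \<in> space M \<Longrightarrow> X 0 \<omega> = 0"
    and indX: "indep_vars (\<lambda>_. count_space UNIV) X {1..}"
    and lawX: "\<And>i. i \<ge> 1 \<Longrightarrow> distr M (count_space UNIV) (X i) = measure_pmf (pmf_of_set {1..k})"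
    and Nk: "\<And>t \<omega>. t \<ge> 0 \<Longrightarrow> \<omega> \<in> space M \<Longrightarrow> Nk t \<omega> = (\<Sum>i = 0..N t \<omega>. X i \<omega>)"
    using assms(4) unfolding poisson_process_of_order_def by (elim exE conjE) (metis (no_types))
  define r where "r = real k * lam"
  define m where "m = (real k + 1) / 2"
  define U where "U = measure_pmf (pmf_of_set {1..k})"
  define v where "v = (\<integral>j. (real j - m)\<^sup>2 \<partial>U)"
  define Y where "Y i \<omega> = real (X i \<omega>) - m" for i \<omega>
  have r: "r > 0"
    using assms by (simp add: r_def)
  have v: "v \<ge> 0"
    by (simp add: v_def)
  have Xm: "X i \<in> measurable M (count_space UNIV)" if "i \<ge> 1" for i
    using indX that by (auto simp: indep_vars_def)
  have Nm: "N t \<in> measurable M (count_space UNIV)" if "t \<ge> 0" for t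
    using N that by (auto simp: poisson_process_def)
  have intU: "integrable U g" for g :: "nat \<Rightarrow> real"
    unfolding U_def using assms(2) by (intro integrable_measure_pmf_finite) simp
  have U: "integral\<^sup>L U g = (\<Sum>j=1..k. g j) / k" for g :: "nat \<Rightarrow> real"
    unfolding U_def using assms(2) by (subst integral_pmf_of_set) auto
  have "(\<Sum>j=1..k. real j) = real k * (real k + 1) / 2"
    by (induction k) (auto simp: field_simps)
  then have meanU: "(\<integral>j. real j - m \<partial>U) = 0"
    unfolding U sum_subtractf by (simp add: m_def)
  have intY: "integrable M (\<lambda>\<omega>. g (X i \<omega>))" "expectation (\<lambda>\<omega>. g (X i \<omega>)) = integral\<^sup>L U g"
    if "i \<ge> 1" for i and g :: "nat \<Rightarrow> real"
    using intU[of g] lawX[OF that] Xm[OF that] integrable_distr_eq[OF Xm[OF that], of g]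
      integral_distr[OF Xm[OF that], of g]
    by (auto simp: U_def)
  have sqY: "integrable M (\<lambda>\<omega>. (Y i \<omega>)\<^sup>2)" and meanY: "expectation (Y i) = 0"
    and varY: "expectation (\<lambda>\<omega>. (Y i \<omega>)\<^sup>2) = v" if "i \<ge> 1" for i
    using intY[OF that, of "\<lambda>j. (real j - m)\<^sup>2"] intY(2)[OF that, of "\<lambda>j. real j - m"] meanU
    unfolding Y_def v_def by simp_all
  have indY: "indep_vars (\<lambda>_. borel) Y {1..}"
    unfolding Y_def by (rule indep_vars_compose2[OF indX]) auto
  \<comment> \<open>The law of each jump gives its bound almost surely; countably many null sets are
    then merged into one.\<close>
  have AEX: "AE \<omega> in M. \<forall>i\<ge>1. X i \<omega> \<le> k"
  proof -
    have "AE \<omega> in M. X i \<omega> \<le> k" if "i \<ge> 1" for i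
    proof -
      have "AE j in distr M (count_space UNIV) (X i). j \<le> k"
        unfolding lawX[OF that] using assms(2) by (auto simp: AE_measure_pmf_iff)
      then show ?thesis
        by (subst (asm) AE_distr_iff) (use Xm[OF that] in auto)
    qed
    then show ?thesis
      by (simp add: AE_all_countable)
  qed
  have Nkm: "(\<lambda>\<omega>. real (Nk t \<omega>)) \<in> borel_measurable M" if "t > 0" for t
  proof -
    have [measurable]: "N t \<in> measurable M (count_space UNIV)"
      using Nm that by simp
    have [measurable]: "(\<lambda>\<omega>. \<Sum>i=1..j. real (X i \<omega>)) \<in> borel_measurable M" for j
      using Xm by (intro borel_measurable_sum measurable_compose[OF Xm]) auto
    \<comment> \<open>The random upper limit takes countably many values, and the sum is measurable
      for each fixed one.\<close>
    have "(\<lambda>\<omega>. \<Sum>i=1..N t \<omega>. real (X i \<omega>)) \<in> borel_measurable M"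
      by measurable
    then show ?thesis
      by (rule measurable_cong[THEN iffD1, rotated])
        (use that in \<open>simp add: Nk X0 sum.atLeast_Suc_atMost\<close>)
  qed
  have "tendsto_in_probability (\<lambda>t \<omega>. real (Nk t \<omega>) / t) (\<lambda>_. m * r) at_top"
  \<comment> \<open>In \<open>C\<close>, the factor 3 comes from squaring a sum of three terms;
    \<open>k^2 * r\<close> accounts for the fluctuation of \<open>N t\<close>, \<open>v * r\<close>
    for that of the jumps, and \<open>(k + m)^2\<close> for rounding \<open>r * t\<close> to an
    integer.\<close>
  proof (rule tendsto_in_probability_linear_second_moment
      [where C = "3 * (k\<^sup>2 * r + v * r + (k + m)\<^sup>2)"])
    fix t :: real
    assume t1: "t \<ge> 1"
    then have t: "t > 0"
      by simp
    define n where "n = nat \<lfloor>r * t\<rfloor>"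
    have n: "\<bar>real n - r * t\<bar> \<le> 1" "real n \<le> r * t"
    proof -
      have "r * t \<ge> 0"
        using r t by simp
      then have "real n = of_int \<lfloor>r * t\<rfloor>"
        by (simp add: n_def)
      then show "\<bar>real n - r * t\<bar> \<le> 1" "real n \<le> r * t"
        by linarith+
    qed
    have [measurable]: "N t \<in> measurable M (count_space UNIV)"
      using Nm t by simp
    have [measurable]: "(\<lambda>\<omega>. \<Sum>i=1..n. Y i \<omega>) \<in> borel_measurable M"
      using indY by (intro borel_measurable_sum) (auto simp: indep_vars_def)
    have S2: "(\<integral>\<^sup>+\<omega>. ennreal ((\<Sum>i=1..n. Y i \<omega>)\<^sup>2) \<partial>M) \<le> ennreal (v * r * t)"
    proof -
      have indn: "indep_vars (\<lambda>_. borel) Y {1..n}"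
        by (rule indep_vars_subset[OF indY]) auto
      have "integrable M (\<lambda>\<omega>. (\<Sum>i=1..n. Y i \<omega>)\<^sup>2)"
        "expectation (\<lambda>\<omega>. (\<Sum>i=1..n. Y i \<omega>)\<^sup>2) = real (card {1..n}) * v"
        using second_moment_sum_indep[OF _ indn, of v] sqY meanY varY by auto
      then have "(\<integral>\<^sup>+\<omega>. ennreal ((\<Sum>i=1..n. Y i \<omega>)\<^sup>2) \<partial>M) = ennreal (real n * v)"
        by (subst nn_integral_eq_integral) auto
      also have "\<dots> \<le> ennreal (v * r * t)"
        using mult_right_mono[OF n(2) v] by (intro ennreal_leI) (simp add: mult_ac)
      finally show ?thesis .
    qed
    have N2: "(\<integral>\<^sup>+\<omega>. ennreal ((real (N t \<omega>) - r * t)\<^sup>2) \<partial>M) = ennreal (r * t)"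
      using t r poisson_process_nn_integral[OF N t, of "\<lambda>n. ennreal ((real n - r * t)\<^sup>2)"]
        nn_integral_poisson_pmf_variance[of "r * t"]
      by (simp add: r_def)
    \<comment> \<open>Rounding costs at most \<open>k\<close> when \<open>N t\<close> is compared
      with \<open>n\<close> instead of \<open>r * t\<close>, and at most \<open>m\<close> when
      \<open>m * n\<close> replaces \<open>m * r * t\<close>.\<close>
    have dev: "\<bar>real (Nk t \<omega>) - m * r * t\<bar> \<le>
        k * \<bar>real (N t \<omega>) - r * t\<bar> + \<bar>\<Sum>i=1..n. Y i \<omega>\<bar> + (k + m)"
      if w: "\<omega> \<in> space M" and X: "\<forall>i\<ge>1. X i \<omega> \<le> k" for \<omega>
    proof -
      let ?S = "\<lambda>j. \<Sum>i=1..j. real (X i \<omega>)"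
      have Nk': "real (Nk t \<omega>) = ?S (N t \<omega>)"
        using w t by (simp add: Nk X0 sum.atLeast_Suc_atMost)
      have Sn: "?S n = (\<Sum>i=1..n. Y i \<omega>) + m * n"
        by (simp add: Y_def sum_subtractf)
      have "\<bar>?S (N t \<omega>) - ?S n\<bar> \<le> k * \<bar>real (N t \<omega>) - real n\<bar>"
        using X by (intro abs_diff_sum_le) auto
      also have "\<dots> \<le> k * (\<bar>real (N t \<omega>) - r * t\<bar> + 1)"
        using n by (intro mult_left_mono) auto
      finally have "\<bar>?S (N t \<omega>) - ?S n\<bar> \<le> k * \<bar>real (N t \<omega>) - r * t\<bar> + k"
        by (simp add: algebra_simps)
      moreover have "\<bar>m * n - m * r * t\<bar> \<le> m"
      proof -
        have "m \<ge> 0"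
          by (simp add: m_def)
        then have "\<bar>m * (real n - r * t)\<bar> \<le> m"
          using mult_left_mono[OF n(1), of m] by (simp add: abs_mult)
        then show ?thesis
          by (simp add: algebra_simps)
      qed
      ultimately show ?thesis
        unfolding Nk' using Sn by linarith
    qed
    have sq: "x\<^sup>2 \<le> 3 * (a\<^sup>2 * b\<^sup>2 + c\<^sup>2 + d\<^sup>2)"
      if "\<bar>x\<bar> \<le> a * \<bar>b\<bar> + \<bar>c\<bar> + d" for a b c d x :: real
    proof -
      have "x\<^sup>2 \<le> (a * \<bar>b\<bar> + \<bar>c\<bar> + d)\<^sup>2"
        using power_mono[OF that abs_ge_zero, of 2] by simp
      \<comment> \<open>The right side minus the left is the sum of the squares of the three
        pairwise differences.\<close>
      also have "\<dots> \<le> 3 * ((a * \<bar>b\<bar>)\<^sup>2 + \<bar>c\<bar>\<^sup>2 + d\<^sup>2)"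
        using zero_le_power2[of "a * \<bar>b\<bar> - \<bar>c\<bar>"] zero_le_power2[of "a * \<bar>b\<bar> - d"]
          zero_le_power2[of "\<bar>c\<bar> - d"]
        unfolding power2_eq_square distrib_left distrib_right left_diff_distrib right_diff_distrib
        by (simp only: mult_ac)
      finally show ?thesis
        by (simp add: power_mult_distrib)
    qed
    have "(\<integral>\<^sup>+\<omega>. ennreal ((real (Nk t \<omega>) - m * r * t)\<^sup>2) \<partial>M) \<le>
        (\<integral>\<^sup>+\<omega>. 3 * (ennreal (k\<^sup>2) * ennreal ((real (N t \<omega>) - r * t)\<^sup>2) +
          ennreal ((\<Sum>i=1..n. Y i \<omega>)\<^sup>2) + ennreal ((k + m)\<^sup>2)) \<partial>M)"
    proof (rule nn_integral_mono_AE, use AEX AE_space in eventually_elim)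
      case (elim \<omega>)
      then have "ennreal ((real (Nk t \<omega>) - m * r * t)\<^sup>2) \<le> ennreal (3 *
          (k\<^sup>2 * (real (N t \<omega>) - r * t)\<^sup>2 + (\<Sum>i=1..n. Y i \<omega>)\<^sup>2 + (k + m)\<^sup>2))"
        using sq[OF dev] by (intro ennreal_leI) simp
      then show ?case
        by (simp add: ennreal_mult' ennreal_plus)
    qed
    also have "\<dots> = 3 * (ennreal (k\<^sup>2) * ennreal (r * t) +
        (\<integral>\<^sup>+\<omega>. ennreal ((\<Sum>i=1..n. Y i \<omega>)\<^sup>2) \<partial>M) + ennreal ((k + m)\<^sup>2))"
      using N2 by (simp add: nn_integral_add nn_integral_cmult emeasure_space_1 del: One_nat_def)
    \<comment> \<open>Here \<open>t \<ge> 1\<close> lets the constant rounding term be absorbed into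
      a bound linear in \<open>t\<close>.\<close>
    also have "\<dots> \<le> 3 * (ennreal (k\<^sup>2) * ennreal (r * t) + ennreal (v * r * t) + ennreal ((k + m)\<^sup>2 * t))"
      using t1 mult_left_mono[OF t1, of "(k + m)\<^sup>2"]
      by (intro mult_left_mono add_mono S2 ennreal_leI order_refl) auto
    also have "\<dots> = ennreal (3 * (k\<^sup>2 * (r * t) + v * r * t + (k + m)\<^sup>2 * t))"
      using v r t by (simp add: ennreal_mult' ennreal_plus)
    also have "3 * (k\<^sup>2 * (r * t) + v * r * t + (k + m)\<^sup>2 * t) =
        3 * (k\<^sup>2 * r + v * r + (k + m)\<^sup>2) * t"
      by (simp add: algebra_simps)
    finally show "(\<integral>\<^sup>+\<omega>. ennreal ((real (Nk t \<omega>) - m * r * t)\<^sup>2) \<partial>M) \<le>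
        ennreal (3 * (k\<^sup>2 * r + v * r + (k + m)\<^sup>2) * t)" .
  qed (use Nkm v r in auto)
  also have "m * r = real k * (real k + 1) / 2 * lam"
    by (simp add: m_def r_def)
  finally show ?thesis .
qed

end
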